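(* Let $R$ be a (commutative) principal ideal domain, $\sigma\in\mathrm{Aut}(R)$, $0\neq a\in R$, $A=R(\sigma,a)$ the corresponding generalized Weyl algebra, $\mathsf p$ a divisor of $a$ and $\mathsf q=\sigma(a/\mathsf p)$. The $A$-module $V_{\mathsf p}$ is simple if and only if the following two conditions hold: (1) all $\mathcal G$-orbits in $\mathrm{Irr}(R)$ are infinite, and (2) whenever $\mathsf p_0\mid\mathsf p$ and $\mathsf q_0\mid\mathsf q$ are irreducibles lying in the same $\mathcal G$-orbit (up to associates), then $\mathsf p_0\preccurlyeq\mathsf q_0$ and $\mathsf p_0\not\sim\mathsf q_0$; in other words, if $[\sigma^n(\mathsf q_0)]\in\mathrm{Irr}(\mathsf p)$ for some $[\mathsf q_0]\in\mathrm{Irr}(\mathsf q)$ and $n\in\mathbb Z$, then $n<0$.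
   Context: Modules are left and unital. The generalized Weyl algebra $R(\sigma,a)$ is the ring generated by $R$, $x$, $y$ subject to $x\sigma(r)=rx$, $yr=\sigma(r)y$ for all $r\in R$, $xy=a$, $yx=\sigma(a)$. For a divisor $\mathsf p$ of $a$ and $\mathsf q=\sigma(a/\mathsf p)$, the $A$-module $V_{\mathsf p}$ is $R$ as an abelian group, with $r'\cdot r=r'r$, $x\cdot r=\sigma^{-1}(r)\mathsf p$, $y\cdot r=\sigma(r)\mathsf q$. Write $r\sim s$ if $r,s\in R$ are associates, and $[r]$ for the class of $r$. $\mathrm{Irr}(R)$ is the set of classes $[r]$ of irreducible elements $r$ of $R$. For $0\ne r\in R$, $\mathrm{Irr}(r)$ is the multiset of classes of irreducible factors of $r$, counted with multiplicity. $\mathcal G=\langle\sigma\rangle\le\mathrm{Aut}(R)$ acts on $\mathrm{Irr}(R)$ by $\sigma\cdot[r]=[\sigma(r)]$. The relation $\preccurlyeq$ on $\mathrm{Irr}(R)$ (also written for representatives) is: $[r]\preccurlyeq[s]$ iff $[\sigma^n(r)]=[s]$ for some $n\ge 0$. *)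

theory Defs
  imports "HOL-Algebra.Algebra"
begin

section \<open>Left modules and simple modules\<close>

text \<open>The library locale \<^locale>\<open>module\<close> requires a commutative ring of scalars. The library
  locale \<^locale>\<open>submodule\<close> does not, and is used as it stands.\<close>

locale left_module = A?: ring A + M?: abelian_group M
  for A :: "('a, 'c) ring_scheme" (structure) and M :: "('a, 'b, 'd) module_scheme" (structure) +
  assumes smult_closed:
      "\<lbrakk>a \<in> carrier A; v \<in> carrier M\<rbrakk> \<Longrightarrow> a \<odot>\<^bsub>M\<^esub> v \<in> carrier M"
    and smult_l_distr:
      "\<lbrakk>a \<in> carrier A; b \<in> carrier A; v \<in> carrier M\<rbrakk> \<Longrightarrow>
        (a \<oplus> b) \<odot>\<^bsub>M\<^esub> v = a \<odot>\<^bsub>M\<^esub> v \<oplus>\<^bsub>M\<^esub> b \<odot>\<^bsub>M\<^esub> v"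
    and smult_r_distr:
      "\<lbrakk>a \<in> carrier A; v \<in> carrier M; w \<in> carrier M\<rbrakk> \<Longrightarrow>
        a \<odot>\<^bsub>M\<^esub> (v \<oplus>\<^bsub>M\<^esub> w) = a \<odot>\<^bsub>M\<^esub> v \<oplus>\<^bsub>M\<^esub> a \<odot>\<^bsub>M\<^esub> w"
    and smult_assoc:
      "\<lbrakk>a \<in> carrier A; b \<in> carrier A; v \<in> carrier M\<rbrakk> \<Longrightarrow>
        (a \<otimes> b) \<odot>\<^bsub>M\<^esub> v = a \<odot>\<^bsub>M\<^esub> (b \<odot>\<^bsub>M\<^esub> v)"
    and smult_one:
      "v \<in> carrier M \<Longrightarrow> \<one> \<odot>\<^bsub>M\<^esub> v = v"

locale simple_left_module = left_module +
  assumes nonzero: "carrier M \<noteq> {\<zero>\<^bsub>M\<^esub>}"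
    and submodule_trivial: "submodule N A M \<Longrightarrow> N = {\<zero>\<^bsub>M\<^esub>} \<or> N = carrier M"


section \<open>Ring automorphisms\<close>

text \<open>As for \<^const>\<open>AutoGroup\<close>, automorphisms are taken to be extensional functions.\<close>

definition ring_auto :: "('a, 'b) ring_scheme \<Rightarrow> ('a \<Rightarrow> 'a) set" where
  "ring_auto R = ring_hom R R \<inter> Bij (carrier R)"

definition ring_AutoGroup :: "('a, 'b) ring_scheme \<Rightarrow> ('a \<Rightarrow> 'a) monoid" where
  "ring_AutoGroup R = BijGroup (carrier R) \<lparr>carrier := ring_auto R\<rparr>"

definition cyclic_auto_group ::
    "('a, 'b) ring_scheme \<Rightarrow> ('a \<Rightarrow> 'a) \<Rightarrow> ('a \<Rightarrow> 'a) monoid" where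
  "cyclic_auto_group R \<sigma> =
     ring_AutoGroup R \<lparr>carrier := generate (ring_AutoGroup R) {\<sigma>}\<rparr>"

lemma ring_auto_closed: "\<sigma> \<in> ring_auto R \<Longrightarrow> r \<in> carrier R \<Longrightarrow> \<sigma> r \<in> carrier R"
  by (auto simp: ring_auto_def ring_hom_def)

lemma ring_auto_inv_into:
  fixes R (structure)
  assumes "ring R" "\<sigma> \<in> ring_auto R"
  shows "restrict (inv_into (carrier R) \<sigma>) (carrier R) \<in> ring_auto R"
proof -
  interpret ring R by fact
  have s: "\<sigma> \<in> ring_hom R R" "\<sigma> \<in> Bij (carrier R)" using assms(2) by (auto simp: ring_auto_def)
  have inj: "inj_on \<sigma> (carrier R)" using s by (simp add: Bij_def bij_betw_def)
  have one: "inv_into (carrier R) \<sigma> \<one> = \<one>"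
    using inv_into_f_f[OF inj one_closed] ring_hom_one[OF s(1)] by simp
  show ?thesis
    unfolding ring_auto_def
  proof (intro IntI ring_hom_memI restrict_inv_into_Bij s(2))
    fix x y assume xy: "x \<in> carrier R" "y \<in> carrier R"
    show "restrict (inv_into (carrier R) \<sigma>) (carrier R) (x \<otimes> y)
      = restrict (inv_into (carrier R) \<sigma>) (carrier R) x
        \<otimes> restrict (inv_into (carrier R) \<sigma>) (carrier R) y"
      using xy Bij_inv_into_lemma[of "carrier R" \<sigma> "(\<otimes>)", OF ring_hom_mult[OF s(1)] s(2)] by auto
    show "restrict (inv_into (carrier R) \<sigma>) (carrier R) (x \<oplus> y)
      = restrict (inv_into (carrier R) \<sigma>) (carrier R) x
        \<oplus> restrict (inv_into (carrier R) \<sigma>) (carrier R) y"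
      using xy Bij_inv_into_lemma[of "carrier R" \<sigma> "(\<oplus>)", OF ring_hom_add[OF s(1)] s(2)] by auto
  qed (use s one in \<open>auto simp: Bij_inv_into_mem\<close>)
qed

lemma ring_auto_subgroup:
  fixes R (structure)
  assumes "ring R"
  shows "subgroup (ring_auto R) (BijGroup (carrier R))"
proof -
  interpret ring R by fact
  show ?thesis
  proof (rule subgroup.intro)
    show "ring_auto R \<subseteq> carrier (BijGroup (carrier R))"
      by (auto simp: ring_auto_def BijGroup_def)
    show "\<one>\<^bsub>BijGroup (carrier R)\<^esub> \<in> ring_auto R"
      by (auto simp: ring_auto_def BijGroup_def id_Bij intro!: ring_hom_memI)
  next
    fix f g assume "f \<in> ring_auto R" "g \<in> ring_auto R"
    then show "f \<otimes>\<^bsub>BijGroup (carrier R)\<^esub> g \<in> ring_auto R"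
      by (auto simp: ring_auto_def BijGroup_def compose_Bij compose_def ring_hom_closed
            ring_hom_mult ring_hom_add ring_hom_one intro!: ring_hom_memI)
         (metis compose_def compose_Bij)
  next
    fix f assume "f \<in> ring_auto R"
    then show "inv\<^bsub>BijGroup (carrier R)\<^esub> f \<in> ring_auto R"
      using ring_auto_inv_into[OF assms] by (auto simp: inv_BijGroup ring_auto_def)
  qed
qed

lemma ring_AutoGroup_group: "ring R \<Longrightarrow> group (ring_AutoGroup R)"
  unfolding ring_AutoGroup_def
  by (rule subgroup.subgroup_is_group[OF ring_auto_subgroup group_BijGroup])


section \<open>Classes of irreducible elements\<close>

text \<open>The class $[r]$ of associates of $r$ is the library's \<open>assocs R r\<close>. The predicate
  \<^const>\<open>ring_irreducible\<close> does not by itself entail membership in the carrier.\<close>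

definition Irr_set :: "('a, 'b) ring_scheme \<Rightarrow> 'a set set" where
  "Irr_set R = {assocs R r | r. r \<in> carrier R \<and> ring_irreducible\<^bsub>R\<^esub> r}"

definition Irr_mset :: "('a, 'b) ring_scheme \<Rightarrow> 'a \<Rightarrow> 'a set multiset" where
  "Irr_mset R r =
     (THE M. \<exists>fs. set fs \<subseteq> carrier R \<and> wfactors R fs r \<and> M = fmset R fs)"

text \<open>The image of the class $[r]$ under $g$ is the class $[g(r)]$; see \<open>Irr_action_assocs\<close>.\<close>

definition Irr_action :: "('a, 'b) ring_scheme \<Rightarrow> ('a \<Rightarrow> 'a) \<Rightarrow> 'a set \<Rightarrow> 'a set" where
  "Irr_action R g = (\<lambda>C \<in> Irr_set R. g ` C)"

definition Irr_le :: "('a, 'b) ring_scheme \<Rightarrow> ('a \<Rightarrow> 'a) \<Rightarrow> 'a set \<Rightarrow> 'a set \<Rightarrow> bool" where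
  "Irr_le R \<sigma> C D \<longleftrightarrow> C \<in> Irr_set R \<and> D \<in> Irr_set R \<and>
     (\<exists>n::nat. Irr_action R (\<sigma> [^]\<^bsub>ring_AutoGroup R\<^esub> n) C = D)"


definition infinite_orbits :: "('a, 'b) ring_scheme \<Rightarrow> ('a \<Rightarrow> 'a) \<Rightarrow> bool" where
  "infinite_orbits R \<sigma> \<longleftrightarrow>
     (\<forall>Q \<in> orbits (cyclic_auto_group R \<sigma>) (Irr_set R) (Irr_action R). infinite Q)"

definition orbit_condition ::
    "('a, 'b) ring_scheme \<Rightarrow> ('a \<Rightarrow> 'a) \<Rightarrow> 'a \<Rightarrow> 'a \<Rightarrow> bool" where
  "orbit_condition R \<sigma> p q \<longleftrightarrow>
     (\<forall>p\<^sub>0 \<in> carrier R. \<forall>q\<^sub>0 \<in> carrier R.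
        ring_irreducible\<^bsub>R\<^esub> p\<^sub>0 \<and> p\<^sub>0 divides\<^bsub>R\<^esub> p \<and>
        ring_irreducible\<^bsub>R\<^esub> q\<^sub>0 \<and> q\<^sub>0 divides\<^bsub>R\<^esub> q \<and>
        (\<exists>Q \<in> orbits (cyclic_auto_group R \<sigma>) (Irr_set R) (Irr_action R).
           assocs R p\<^sub>0 \<in> Q \<and> assocs R q\<^sub>0 \<in> Q) \<longrightarrow>
        Irr_le R \<sigma> (assocs R p\<^sub>0) (assocs R q\<^sub>0) \<and> \<not> p\<^sub>0 \<sim>\<^bsub>R\<^esub> q\<^sub>0)"

text \<open>The reformulation of the preceding condition by powers of $\sigma$. The two agree when all
  orbits are infinite, but not in general.\<close>

definition orbit_condition_pow ::
    "('a, 'b) ring_scheme \<Rightarrow> ('a \<Rightarrow> 'a) \<Rightarrow> 'a \<Rightarrow> 'a \<Rightarrow> bool" where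
  "orbit_condition_pow R \<sigma> p q \<longleftrightarrow>
     (\<forall>q\<^sub>0 \<in> carrier R. \<forall>n::int.
        assocs R q\<^sub>0 \<in># Irr_mset R q \<and>
        assocs R ((\<sigma> [^]\<^bsub>ring_AutoGroup R\<^esub> n) q\<^sub>0) \<in># Irr_mset R p \<longrightarrow> n < 0)"


section \<open>Generalized Weyl algebras\<close>

text \<open>The ring generated by $R$, $x$, $y$ subject to the defining relations: ring expressions over
  the generators, modulo the least congruence that contains the ring axioms, identifies the ring
  operations on constants with those of $R$, and contains the relations
  $x\sigma(r) = rx$, $yr = \sigma(r)y$, $xy = a$ and $yx = \sigma(a)$.
  Zero and one are the constants of $R$.\<close>

datatype 'a gwa_expr =
    Const 'a | Gen_x | Gen_y
  | Add "'a gwa_expr" "'a gwa_expr"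
  | Neg "'a gwa_expr"
  | Mul "'a gwa_expr" "'a gwa_expr"

definition gwa_exprs :: "('a, 'b) ring_scheme \<Rightarrow> 'a gwa_expr set" where
  "gwa_exprs R = {e. set_gwa_expr e \<subseteq> carrier R}"

inductive gwa_cong ::
    "('a, 'b) ring_scheme \<Rightarrow> ('a \<Rightarrow> 'a) \<Rightarrow> 'a \<Rightarrow> 'a gwa_expr \<Rightarrow> 'a gwa_expr \<Rightarrow> bool"
  for R \<sigma> a where
  refl: "e \<in> gwa_exprs R \<Longrightarrow> gwa_cong R \<sigma> a e e"
| sym: "gwa_cong R \<sigma> a e f \<Longrightarrow> gwa_cong R \<sigma> a f e"
| trans: "\<lbrakk>gwa_cong R \<sigma> a e f; gwa_cong R \<sigma> a f g\<rbrakk> \<Longrightarrow> gwa_cong R \<sigma> a e g"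
| Add_cong: "\<lbrakk>gwa_cong R \<sigma> a e e'; gwa_cong R \<sigma> a f f'\<rbrakk> \<Longrightarrow>
    gwa_cong R \<sigma> a (Add e f) (Add e' f')"
| Neg_cong: "gwa_cong R \<sigma> a e e' \<Longrightarrow> gwa_cong R \<sigma> a (Neg e) (Neg e')"
| Mul_cong: "\<lbrakk>gwa_cong R \<sigma> a e e'; gwa_cong R \<sigma> a f f'\<rbrakk> \<Longrightarrow>
    gwa_cong R \<sigma> a (Mul e f) (Mul e' f')"
| Add_assoc: "\<lbrakk>e \<in> gwa_exprs R; f \<in> gwa_exprs R; g \<in> gwa_exprs R\<rbrakk> \<Longrightarrow>
    gwa_cong R \<sigma> a (Add (Add e f) g) (Add e (Add f g))"
| Add_comm: "\<lbrakk>e \<in> gwa_exprs R; f \<in> gwa_exprs R\<rbrakk> \<Longrightarrow>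
    gwa_cong R \<sigma> a (Add e f) (Add f e)"
| Add_zero: "e \<in> gwa_exprs R \<Longrightarrow> gwa_cong R \<sigma> a (Add (Const \<zero>\<^bsub>R\<^esub>) e) e"
| Add_Neg: "e \<in> gwa_exprs R \<Longrightarrow> gwa_cong R \<sigma> a (Add (Neg e) e) (Const \<zero>\<^bsub>R\<^esub>)"
| Mul_assoc: "\<lbrakk>e \<in> gwa_exprs R; f \<in> gwa_exprs R; g \<in> gwa_exprs R\<rbrakk> \<Longrightarrow>
    gwa_cong R \<sigma> a (Mul (Mul e f) g) (Mul e (Mul f g))"
| one_Mul: "e \<in> gwa_exprs R \<Longrightarrow> gwa_cong R \<sigma> a (Mul (Const \<one>\<^bsub>R\<^esub>) e) e"
| Mul_one: "e \<in> gwa_exprs R \<Longrightarrow> gwa_cong R \<sigma> a (Mul e (Const \<one>\<^bsub>R\<^esub>)) e"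
| distrib_right: "\<lbrakk>e \<in> gwa_exprs R; f \<in> gwa_exprs R; g \<in> gwa_exprs R\<rbrakk> \<Longrightarrow>
    gwa_cong R \<sigma> a (Mul (Add e f) g) (Add (Mul e g) (Mul f g))"
| distrib_left: "\<lbrakk>e \<in> gwa_exprs R; f \<in> gwa_exprs R; g \<in> gwa_exprs R\<rbrakk> \<Longrightarrow>
    gwa_cong R \<sigma> a (Mul g (Add e f)) (Add (Mul g e) (Mul g f))"
| Const_add: "\<lbrakk>r \<in> carrier R; s \<in> carrier R\<rbrakk> \<Longrightarrow>
    gwa_cong R \<sigma> a (Const (r \<oplus>\<^bsub>R\<^esub> s)) (Add (Const r) (Const s))"
| Const_mult: "\<lbrakk>r \<in> carrier R; s \<in> carrier R\<rbrakk> \<Longrightarrow>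
    gwa_cong R \<sigma> a (Const (r \<otimes>\<^bsub>R\<^esub> s)) (Mul (Const r) (Const s))"
| X_Const: "r \<in> carrier R \<Longrightarrow>
    gwa_cong R \<sigma> a (Mul Gen_x (Const (\<sigma> r))) (Mul (Const r) Gen_x)"
| Y_Const: "r \<in> carrier R \<Longrightarrow>
    gwa_cong R \<sigma> a (Mul Gen_y (Const r)) (Mul (Const (\<sigma> r)) Gen_y)"
| X_Y: "gwa_cong R \<sigma> a (Mul Gen_x Gen_y) (Const a)"
| Y_X: "gwa_cong R \<sigma> a (Mul Gen_y Gen_x) (Const (\<sigma> a))"

definition gwa_class ::
    "('a, 'b) ring_scheme \<Rightarrow> ('a \<Rightarrow> 'a) \<Rightarrow> 'a \<Rightarrow> 'a gwa_expr \<Rightarrow> 'a gwa_expr set" where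
  "gwa_class R \<sigma> a e = {f. gwa_cong R \<sigma> a e f}"

definition GWA ::
    "('a, 'b) ring_scheme \<Rightarrow> ('a \<Rightarrow> 'a) \<Rightarrow> 'a \<Rightarrow> 'a gwa_expr set ring" where
  "GWA R \<sigma> a =
     \<lparr>carrier = gwa_class R \<sigma> a ` gwa_exprs R,
      monoid.mult = (\<lambda>C D. \<Union>e\<in>C. \<Union>f\<in>D. gwa_class R \<sigma> a (Mul e f)),
      monoid.one = gwa_class R \<sigma> a (Const \<one>\<^bsub>R\<^esub>),
      ring.zero = gwa_class R \<sigma> a (Const \<zero>\<^bsub>R\<^esub>),
      add = (\<lambda>C D. \<Union>e\<in>C. \<Union>f\<in>D. gwa_class R \<sigma> a (Add e f))\<rparr>"


section \<open>The modules $V_{\mathsf p}$\<close>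

definition exact_quotient :: "('a, 'b) ring_scheme \<Rightarrow> 'a \<Rightarrow> 'a \<Rightarrow> 'a" where
  "exact_quotient R a p = (THE b. b \<in> carrier R \<and> a = p \<otimes>\<^bsub>R\<^esub> b)"

primrec gwa_act ::
    "('a, 'b) ring_scheme \<Rightarrow> ('a \<Rightarrow> 'a) \<Rightarrow> 'a \<Rightarrow> 'a \<Rightarrow> 'a gwa_expr \<Rightarrow> 'a \<Rightarrow> 'a" where
  "gwa_act R \<sigma> p q (Const r') r = r' \<otimes>\<^bsub>R\<^esub> r"
| "gwa_act R \<sigma> p q Gen_x r = inv_into (carrier R) \<sigma> r \<otimes>\<^bsub>R\<^esub> p"
| "gwa_act R \<sigma> p q Gen_y r = \<sigma> r \<otimes>\<^bsub>R\<^esub> q"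
| "gwa_act R \<sigma> p q (Add e f) r = gwa_act R \<sigma> p q e r \<oplus>\<^bsub>R\<^esub> gwa_act R \<sigma> p q f r"
| "gwa_act R \<sigma> p q (Neg e) r = \<ominus>\<^bsub>R\<^esub> gwa_act R \<sigma> p q e r"
| "gwa_act R \<sigma> p q (Mul e f) r = gwa_act R \<sigma> p q e (gwa_act R \<sigma> p q f r)"

text \<open>Congruent expressions act equally, so the image below is a singleton. The fields
  \<^const>\<open>monoid.mult\<close> and \<^const>\<open>monoid.one\<close> of a module record carry no meaning.\<close>

definition V_mod ::
    "('a, 'b) ring_scheme \<Rightarrow> ('a \<Rightarrow> 'a) \<Rightarrow> 'a \<Rightarrow> 'a \<Rightarrow> ('a gwa_expr set, 'a) module" where
  "V_mod R \<sigma> a p =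
     \<lparr>carrier = carrier R, monoid.mult = undefined, monoid.one = undefined,
      ring.zero = \<zero>\<^bsub>R\<^esub>, add = (\<oplus>\<^bsub>R\<^esub>),
      smult = (\<lambda>C r. the_elem
        ((\<lambda>e. gwa_act R \<sigma> p (\<sigma> (exact_quotient R a p)) e r) ` C))\<rparr>"


section \<open>Well-definedness\<close>

lemma gwa_exprs_simps [simp]:
  "Const r \<in> gwa_exprs R \<longleftrightarrow> r \<in> carrier R"
  "Gen_x \<in> gwa_exprs R"
  "Gen_y \<in> gwa_exprs R"
  "Add e f \<in> gwa_exprs R \<longleftrightarrow> e \<in> gwa_exprs R \<and> f \<in> gwa_exprs R"
  "Neg e \<in> gwa_exprs R \<longleftrightarrow> e \<in> gwa_exprs R"
  "Mul e f \<in> gwa_exprs R \<longleftrightarrow> e \<in> gwa_exprs R \<and> f \<in> gwa_exprs R"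
  by (auto simp: gwa_exprs_def)

lemma Irr_action_assocs:
  fixes R (structure)
  assumes "ring R" "g \<in> ring_auto R" "r \<in> carrier R" "ring_irreducible\<^bsub>R\<^esub> r"
  shows "Irr_action R g (assocs R r) = assocs R (g r)"
proof -
  interpret ring R by fact
  define h where "h = restrict (inv_into (carrier R) g) (carrier R)"
  have h: "h \<in> ring_auto R" unfolding h_def by (rule ring_auto_inv_into[OF assms(1,2)])
  have gh: "g (h x) = x" "h (g x) = x" if "x \<in> carrier R" for x
    using that assms(2) unfolding h_def ring_auto_def Bij_def bij_betw_def
    by (auto simp: f_inv_into_f image_def)
  have img: "f x divides f y" if "f \<in> ring_auto R" "x divides y" "x \<in> carrier R" for f x y
    using that unfolding factor_def ring_auto_def by (auto simp: ring_hom_mult ring_hom_closed)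
  have assoc: "f x \<sim> f y" if "f \<in> ring_auto R" "x \<sim> y" "x \<in> carrier R" "y \<in> carrier R" for f x y
    using that img unfolding associated_def by auto
  have eq: "assocs R s = {y \<in> carrier R. y \<sim> s}" for s
    by (auto simp: eq_closure_of_def elem_def)
  have "g ` assocs R r = assocs R (g r)"
  proof (intro equalityI subsetI)
    fix y assume "y \<in> g ` assocs R r"
    then show "y \<in> assocs R (g r)"
      using assoc[OF assms(2)] assms by (auto simp: eq ring_auto_closed)
  next
    fix y assume "y \<in> assocs R (g r)"
    then have y: "y \<in> carrier R" "y \<sim> g r" by (auto simp: eq)
    have "h y \<sim> h (g r)" using assoc[OF h y(2)] y assms by (simp add: ring_auto_closed)
    then have "h y \<in> assocs R r" using y h assms by (auto simp: eq gh ring_auto_closed)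
    then show "y \<in> g ` assocs R r" using gh(1)[OF y(1)] by force
  qed
  moreover have "assocs R r \<in> Irr_set R" unfolding Irr_set_def using assms by blast
  ultimately show ?thesis by (simp add: Irr_action_def)
qed

lemma (in principal_domain) Irr_mset_eq:
  assumes "r \<in> carrier R" "r \<noteq> \<zero>" "set fs \<subseteq> carrier R" "wfactors R fs r"
  shows "Irr_mset R r = fmset R fs"
proof -
  have closed: "foldr (\<otimes>) gs \<one> \<in> carrier R" if "set gs \<subseteq> carrier R" for gs
    using that by (induction gs) auto
  have zero: "foldr (\<otimes>) gs \<one> = \<zero>" if "\<zero> \<in> set gs" "set gs \<subseteq> carrier R" for gs
    using that by (induction gs) (auto simp: closed)
  have mult_of: "set gs \<subseteq> carrier (mult_of R) \<and> wfactors (mult_of R) gs r \<and>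
      fmset (mult_of R) gs = fmset R gs"
    if gs: "set gs \<subseteq> carrier R" "wfactors R gs r" for gs
  proof -
    have asc: "foldr (\<otimes>) gs \<one> \<sim> r" using gs by (simp add: wfactors_def)
    have "\<zero> \<notin> set gs"
    proof
      assume "\<zero> \<in> set gs"
      with asc gs zero have "\<zero> divides r" by (simp add: associated_def)
      then show False using assms(1,2) by (auto simp: factor_def)
    qed
    then have carr: "set gs \<subseteq> carrier (mult_of R)" using gs by auto
    have "assocs (mult_of R) x = assocs R x" if "x \<in> set gs" for x
    proof -
      have x: "x \<in> carrier R" "x \<noteq> \<zero>" using that carr by auto
      have "\<not> \<zero> \<sim> x" using x by (auto simp: associated_def factor_def)
      then show ?thesis
        using x assoc_iff_assoc_mult[of _ x] by (auto simp: eq_closure_of_def elem_def)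
    qed
    then have "fmset (mult_of R) gs = fmset R gs"
      unfolding fmset_def by (intro arg_cong[where f = mset] map_cong) auto
    moreover have "wfactors (mult_of R) gs r"
      using gs asc assoc_iff_assoc_mult[OF closed[OF gs(1)] assms(1)]
      by (auto simp: wfactors_def intro!: irreducible_imp_irreducible_mult)
    ultimately show ?thesis using carr by simp
  qed
  have "fmset R gs = fmset R fs" if "set gs \<subseteq> carrier R" "wfactors R gs r" for gs
  proof -
    have "essentially_equal (mult_of R) gs fs"
      using mult_of[OF that] mult_of[OF assms(3,4)] assms(1,2)
      by (intro mult_of.wfactors_unique) auto
    then show ?thesis
      using mult_of.ee_fmset[of gs fs] mult_of[OF that] mult_of[OF assms(3,4)] by simp
  qed
  then show ?thesis
    unfolding Irr_mset_def using assms(3,4) by (intro the_equality) blast+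
qed

context
  fixes R :: "('a, 'b) ring_scheme" (structure) and \<sigma> a
  assumes R: "cring R" and \<sigma>: "\<sigma> \<in> ring_auto R" and a: "a \<in> carrier R"
begin

interpretation cring R by (rule R)

lemma gwa_cong_exprs:
  "gwa_cong R \<sigma> a e f \<Longrightarrow> e \<in> gwa_exprs R \<and> f \<in> gwa_exprs R"
  by (induction rule: gwa_cong.induct) (use \<sigma> a in \<open>auto simp: ring_auto_closed\<close>)

lemma gwa_class_eq_iff:
  assumes "e \<in> gwa_exprs R"
  shows "gwa_class R \<sigma> a f = gwa_class R \<sigma> a e \<longleftrightarrow> gwa_cong R \<sigma> a f e"
proof
  assume "gwa_class R \<sigma> a f = gwa_class R \<sigma> a e"
  moreover have "e \<in> gwa_class R \<sigma> a e" using assms by (simp add: gwa_class_def gwa_cong.refl)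
  ultimately have "e \<in> gwa_class R \<sigma> a f" by simp
  then show "gwa_cong R \<sigma> a f e" by (simp add: gwa_class_def)
next
  assume fe: "gwa_cong R \<sigma> a f e"
  have "gwa_cong R \<sigma> a f g \<longleftrightarrow> gwa_cong R \<sigma> a e g" for g
    using gwa_cong.trans[OF fe, of g] gwa_cong.trans[OF gwa_cong.sym[OF fe], of g] by iprover
  then show "gwa_class R \<sigma> a f = gwa_class R \<sigma> a e" by (simp add: gwa_class_def)
qed

lemma gwa_class_cong: "gwa_cong R \<sigma> a e f \<Longrightarrow> gwa_class R \<sigma> a e = gwa_class R \<sigma> a f"
  using gwa_class_eq_iff[of f e] gwa_cong_exprs[of e f] by simp

lemma gwa_class_self: "e \<in> gwa_exprs R \<Longrightarrow> e \<in> gwa_class R \<sigma> a e"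
  by (simp add: gwa_class_def gwa_cong.refl)

lemma GWA_add:
  assumes "e \<in> gwa_exprs R" "f \<in> gwa_exprs R"
  shows "gwa_class R \<sigma> a e \<oplus>\<^bsub>GWA R \<sigma> a\<^esub> gwa_class R \<sigma> a f = gwa_class R \<sigma> a (Add e f)"
proof -
  have "gwa_class R \<sigma> a (Add e' f') = gwa_class R \<sigma> a (Add e f)"
    if "e' \<in> gwa_class R \<sigma> a e" "f' \<in> gwa_class R \<sigma> a f" for e' f'
    using that unfolding gwa_class_def[of _ _ _ e] gwa_class_def[of _ _ _ f]
    by (intro gwa_class_cong gwa_cong.Add_cong) (simp_all add: gwa_cong.sym)
  then have "(\<Union>e'\<in>gwa_class R \<sigma> a e. \<Union>f'\<in>gwa_class R \<sigma> a f. gwa_class R \<sigma> a (Add e' f'))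
      = (\<Union>e'\<in>gwa_class R \<sigma> a e. \<Union>f'\<in>gwa_class R \<sigma> a f. gwa_class R \<sigma> a (Add e f))"
    by (intro SUP_cong HOL.refl)
  moreover have "gwa_class R \<sigma> a e \<noteq> {}" "gwa_class R \<sigma> a f \<noteq> {}"
    using gwa_class_self[OF assms(1)] gwa_class_self[OF assms(2)] by blast+
  ultimately show ?thesis by (simp add: GWA_def)
qed

lemma GWA_mult:
  assumes "e \<in> gwa_exprs R" "f \<in> gwa_exprs R"
  shows "gwa_class R \<sigma> a e \<otimes>\<^bsub>GWA R \<sigma> a\<^esub> gwa_class R \<sigma> a f = gwa_class R \<sigma> a (Mul e f)"
proof -
  have "gwa_class R \<sigma> a (Mul e' f') = gwa_class R \<sigma> a (Mul e f)"
    if "e' \<in> gwa_class R \<sigma> a e" "f' \<in> gwa_class R \<sigma> a f" for e' f'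
    using that unfolding gwa_class_def[of _ _ _ e] gwa_class_def[of _ _ _ f]
    by (intro gwa_class_cong gwa_cong.Mul_cong) (simp_all add: gwa_cong.sym)
  then have "(\<Union>e'\<in>gwa_class R \<sigma> a e. \<Union>f'\<in>gwa_class R \<sigma> a f. gwa_class R \<sigma> a (Mul e' f'))
      = (\<Union>e'\<in>gwa_class R \<sigma> a e. \<Union>f'\<in>gwa_class R \<sigma> a f. gwa_class R \<sigma> a (Mul e f))"
    by (intro SUP_cong HOL.refl)
  moreover have "gwa_class R \<sigma> a e \<noteq> {}" "gwa_class R \<sigma> a f \<noteq> {}"
    using gwa_class_self[OF assms(1)] gwa_class_self[OF assms(2)] by blast+
  ultimately show ?thesis by (simp add: GWA_def)
qed

lemma GWA_ring: "ring (GWA R \<sigma> a)"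
proof -
  let ?A = "GWA R \<sigma> a" and ?c = "gwa_class R \<sigma> a"
  have [simp]: "carrier ?A = ?c ` gwa_exprs R" "\<zero>\<^bsub>?A\<^esub> = ?c (Const \<zero>)" "\<one>\<^bsub>?A\<^esub> = ?c (Const \<one>)"
    by (simp_all add: GWA_def)
  note [simp] = GWA_add GWA_mult
    gwa_class_cong[OF gwa_cong.Add_assoc]
    gwa_class_cong[OF gwa_cong.Add_zero] gwa_class_cong[OF gwa_cong.Add_Neg]
    gwa_class_cong[OF gwa_cong.Mul_assoc] gwa_class_cong[OF gwa_cong.one_Mul]
    gwa_class_cong[OF gwa_cong.Mul_one] gwa_class_cong[OF gwa_cong.distrib_left]
    gwa_class_cong[OF gwa_cong.distrib_right]
  have grp: "abelian_group ?A"
  proof (rule abelian_groupI)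
    fix C assume "C \<in> carrier ?A"
    then obtain e where e: "e \<in> gwa_exprs R" "C = ?c e" by auto
    then have "?c (Neg e) \<oplus>\<^bsub>?A\<^esub> C = \<zero>\<^bsub>?A\<^esub>"
      by simp
    moreover have "?c (Neg e) \<in> carrier ?A" using e by auto
    ultimately show "\<exists>D\<in>carrier ?A. D \<oplus>\<^bsub>?A\<^esub> C = \<zero>\<^bsub>?A\<^esub>" by blast
  next
    fix C D assume "C \<in> carrier ?A" "D \<in> carrier ?A"
    then show "C \<oplus>\<^bsub>?A\<^esub> D = D \<oplus>\<^bsub>?A\<^esub> C"
      by (auto simp: gwa_class_cong[OF gwa_cong.Add_comm])
  qed auto
  have mon: "monoid ?A"
    by (rule monoidI) auto
  show ?thesis
    by (rule ringI[OF grp mon]) auto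
qed

end

context
  fixes R :: "('a, 'b) ring_scheme" (structure) and \<sigma> a p
  assumes R: "domain R" and \<sigma>: "\<sigma> \<in> ring_auto R" and a: "a \<in> carrier R" "a \<noteq> \<zero>"
    and p: "p \<in> carrier R" "p divides a"
begin

interpretation domain R by (rule R)

lemma exact_quotient: "exact_quotient R a p \<in> carrier R \<and> a = p \<otimes> exact_quotient R a p"
proof -
  obtain b where b: "b \<in> carrier R" "a = p \<otimes> b" using p by (auto simp: factor_def)
  then have "p \<noteq> \<zero>" using a by auto
  then have "\<exists>!b. b \<in> carrier R \<and> a = p \<otimes> b"
    using b p m_lcancel[of p] by (intro ex1I[of _ b]) auto
  then show ?thesis unfolding exact_quotient_def by (rule theI')
qed

private abbreviation (input) "q \<equiv> \<sigma> (exact_quotient R a p)"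
private abbreviation (input) "\<tau> \<equiv> inv_into (carrier R) \<sigma>"
private abbreviation (input) "act \<equiv> gwa_act R \<sigma> p q"

private lemma hom: "\<sigma> \<in> ring_hom R R" using \<sigma> by (simp add: ring_auto_def)

private lemma tau_hom: "restrict \<tau> (carrier R) \<in> ring_hom R R"
  using ring_auto_inv_into[OF ring_axioms \<sigma>] by (simp add: ring_auto_def)

private lemma tau_closed: "r \<in> carrier R \<Longrightarrow> \<tau> r \<in> carrier R"
  using ring_hom_closed[OF tau_hom] by auto

private lemma tau_mult: "r \<in> carrier R \<Longrightarrow> s \<in> carrier R \<Longrightarrow> \<tau> (r \<otimes> s) = \<tau> r \<otimes> \<tau> s"
  using ring_hom_mult[OF tau_hom, of r s] by auto

private lemma tau_add: "r \<in> carrier R \<Longrightarrow> s \<in> carrier R \<Longrightarrow> \<tau> (r \<oplus> s) = \<tau> r \<oplus> \<tau> s"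
  using ring_hom_add[OF tau_hom, of r s] by auto

private lemma sigma_tau: "r \<in> carrier R \<Longrightarrow> \<sigma> (\<tau> r) = r" "r \<in> carrier R \<Longrightarrow> \<tau> (\<sigma> r) = r"
  using \<sigma> unfolding ring_auto_def Bij_def bij_betw_def by (auto simp: f_inv_into_f)

private lemma q: "q \<in> carrier R" "\<tau> q \<otimes> p = a" "\<sigma> p \<otimes> q = \<sigma> a"
  using exact_quotient p hom
  by (auto simp: ring_hom_closed sigma_tau m_comm ring_hom_mult[OF hom, symmetric])

lemma gwa_act_closed: "e \<in> gwa_exprs R \<Longrightarrow> r \<in> carrier R \<Longrightarrow> act e r \<in> carrier R"
  by (induction e arbitrary: r) (use p q hom in \<open>auto simp: tau_closed ring_hom_closed\<close>)

lemma gwa_act_add: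
  "e \<in> gwa_exprs R \<Longrightarrow> r \<in> carrier R \<Longrightarrow> s \<in> carrier R \<Longrightarrow>
    act e (r \<oplus> s) = act e r \<oplus> act e s"
  by (induction e arbitrary: r s)
     (use p q hom in \<open>auto simp: tau_closed tau_add ring_hom_closed ring_hom_add r_distr l_distr
        gwa_act_closed minus_add a_ac\<close>)

lemma gwa_act_cong:
  "gwa_cong R \<sigma> a e f \<Longrightarrow> r \<in> carrier R \<Longrightarrow> act e r = act f r"
proof (induction arbitrary: r rule: gwa_cong.induct)
  case (Mul_cong e e' f f')
  have "f' \<in> gwa_exprs R"
    using gwa_cong_exprs[OF is_cring \<sigma> a(1) Mul_cong.hyps(2)] by simp
  with Mul_cong show ?case by (simp add: gwa_act_closed)
next
  case (X_Const s)
  then show ?case using p hom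
    by (simp add: tau_mult tau_closed sigma_tau ring_hom_closed m_assoc)
next
  case (Y_Const s)
  then show ?case using p q hom by (simp add: ring_hom_mult ring_hom_closed m_assoc)
next
  case X_Y
  then show ?case using p q hom
    by (simp add: tau_mult tau_closed sigma_tau ring_hom_closed m_assoc) (simp add: m_comm a)
next
  case Y_X
  then show ?case using p q hom a
    by (simp add: ring_hom_mult sigma_tau tau_closed ring_hom_closed m_assoc)
       (simp add: m_comm ring_hom_closed)
qed (use p q hom in \<open>auto simp: gwa_act_closed gwa_act_add l_distr l_neg m_assoc a_assoc\<close>,
     auto simp: a_comm gwa_act_closed)

lemma V_mod_smult:
  assumes "e \<in> gwa_exprs R" "r \<in> carrier R"
  shows "gwa_class R \<sigma> a e \<odot>\<^bsub>V_mod R \<sigma> a p\<^esub> r = act e r"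
proof -
  have "(\<lambda>f. act f r) ` gwa_class R \<sigma> a e = {act e r}"
    using assms gwa_act_cong[of e _ r] gwa_cong.refl[OF assms(1)]
    unfolding gwa_class_def by auto
  then show ?thesis by (simp add: V_mod_def)
qed

lemma V_mod_left_module: "left_module (GWA R \<sigma> a) (V_mod R \<sigma> a p)"
proof -
  let ?A = "GWA R \<sigma> a" and ?V = "V_mod R \<sigma> a p" and ?c = "gwa_class R \<sigma> a"
  have [simp]: "carrier ?A = ?c ` gwa_exprs R" "\<one>\<^bsub>?A\<^esub> = ?c (Const \<one>)"
    by (simp_all add: GWA_def)
  have [simp]: "carrier ?V = carrier R" "add ?V = add R" "\<zero>\<^bsub>?V\<^esub> = \<zero>"
    by (simp_all add: V_mod_def)
  note [simp] = GWA_add[OF is_cring \<sigma> a(1)] GWA_mult[OF is_cring \<sigma> a(1)] V_mod_smult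
    gwa_act_closed gwa_act_add
  have "abelian_group ?V"
    by (rule abelian_groupI) (auto simp: a_ac intro: l_neg a_inv_closed)
  with GWA_ring[OF is_cring \<sigma> a(1)] show ?thesis
    by (intro left_module.intro left_module_axioms.intro) auto
qed

end

end

theory Submission
  imports Defs
begin

text \<open>Constants of \<open>R\<close> act on \<open>V\<^sub>p\<close> by multiplication, so the submodules of \<open>V\<^sub>p\<close> are the ideals
  \<open>dR\<close> that are stable under \<open>x\<close> and \<open>y\<close>, that is, with \<open>d\<close> dividing both \<open>\<sigma>\<^sup>-\<^sup>1(d) p\<close> and
  \<open>\<sigma>(d) q\<close>. If \<open>r\<close> is an irreducible factor of \<open>q\<close> and \<open>\<sigma>\<^sup>n(r)\<close> divides \<open>p\<close> for some
  \<open>n \<ge> 0\<close>, the product \<open>d = r \<sigma>(r) \<cdots> \<sigma>\<^sup>n(r)\<close> spans a proper nonzero submodule, because the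
  factors of \<open>d\<close> and of \<open>\<sigma>(d)\<close> differ only at the two ends of the chain; the same product over
  a full finite orbit works for all \<open>p\<close> and \<open>q\<close>. Conversely, if the orbits are infinite and \<open>d\<close> is
  neither zero nor a unit, let \<open>r\<close> be an irreducible factor of \<open>d\<close>. The largest \<open>n\<close> and the
  smallest \<open>m\<close> for which \<open>\<sigma>\<^sup>n(r)\<close> and \<open>\<sigma>\<^sup>m(r)\<close> divide \<open>d\<close> satisfy \<open>m \<le> n\<close>, and stability of
  \<open>dR\<close> forces \<open>\<sigma>\<^sup>n(r)\<close> to divide \<open>p\<close> and \<open>\<sigma>\<^sup>m(r)\<close> to divide \<open>q\<close>.\<close>

section \<open>Divisibility in principal ideal domains\<close>

lemma (in monoid) assocs_eq_iff:
  assumes "x \<in> carrier G" "y \<in> carrier G"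
  shows "assocs G x = assocs G y \<longleftrightarrow> x \<sim> y"
proof -
  have eq: "assocs G s = {z \<in> carrier G. z \<sim> s}" for s
    by (auto simp: eq_closure_of_def elem_def)
  show ?thesis
  proof
    assume "assocs G x = assocs G y"
    moreover have "x \<in> assocs G x" using assms by (simp add: eq)
    ultimately show "x \<sim> y" by (simp add: eq)
  next
    assume "x \<sim> y"
    then show "assocs G x = assocs G y"
      using associated_trans[of _ x y] associated_trans[of _ y x] associated_sym[of x y] assms
      unfolding eq by blast
  qed
qed

context principal_domain
begin

lemma irreducible_dvd_mult:
  assumes "r \<in> carrier R" "ring_irreducible r" "x \<in> carrier R" "y \<in> carrier R"
    and "r divides x \<otimes> y"
  shows "r divides x \<or> r divides y"
  using assms primeness_condition[of r] by (auto simp: ring_prime_def elim: primeE)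

lemma ring_irreducible_associated:
  assumes "r \<in> carrier R" "ring_irreducible r" "s \<in> carrier R" "s \<sim> r"
  shows "ring_irreducible s"
proof (rule ring_irreducibleI)
  obtain u where u: "u \<in> Units R" "s = u \<otimes> r"
    using assms ring_associated_iff by auto
  have r0: "r \<noteq> \<zero>" "r \<notin> Units R" using ring_irreducibleE[OF assms(1,2)] by auto
  show "s \<in> carrier R - {\<zero>}"
    using assms(3,4) r0(1) by (metis DiffI associated_def singletonD zero_divides)
  show "s \<notin> Units R"
    using divides_unit[of r s] assms(1,4) r0(2) unfolding associated_def by blast
  fix x y assume xy: "x \<in> carrier R" "y \<in> carrier R" "s = x \<otimes> y"
  have uc: "u \<in> carrier R" "inv u \<in> carrier R" using u by auto
  have "r = inv u \<otimes> s" using u uc assms by (simp add: m_assoc[symmetric])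
  also have "\<dots> = (inv u \<otimes> x) \<otimes> y" using xy uc by (simp add: m_assoc)
  finally have "inv u \<otimes> x \<in> Units R \<or> y \<in> Units R"
    using ring_irreducibleE(5)[OF assms(1,2), of "inv u \<otimes> x" y] xy uc by simp
  then show "x \<in> Units R \<or> y \<in> Units R"
    using xy(1) uc u(1) unit_factor[of x "inv u"] by (simp add: m_comm) blast
qed

text \<open>An irreducible dividing a product of irreducibles divides one of them and is then
  associated to it, so the classes in a factorization are exactly those of the irreducible divisors.
  The finiteness clause later bounds how many members of one orbit divide a given element.\<close>

lemma in_Irr_mset_iff:
  assumes "r \<in> carrier R" "r \<noteq> \<zero>" "s \<in> carrier R"
  shows "assocs R s \<in># Irr_mset R r \<longleftrightarrow> ring_irreducible s \<and> s divides r"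
    and "finite {assocs R s |s. s \<in> carrier R \<and> ring_irreducible s \<and> s divides r}"
proof -
  \<comment> \<open>Factorizations exist in the factorial monoid \<open>mult_of R\<close> of nonzero
    elements; the list is then transferred to \<open>R\<close>, where \<open>Irr_mset\<close> is
    defined.\<close>
  obtain fs where fs: "set fs \<subseteq> carrier (mult_of R)" "wfactors (mult_of R) fs r"
    using mult_of.wfactors_exist[of r] assms by auto
  have carr: "set fs \<subseteq> carrier R" "foldr (\<otimes>) fs \<one> \<in> carrier R"
    using fs(1) by (auto simp: multlist_closed)
  have irr: "ring_irreducible f \<and> f divides r" if "f \<in> set fs" for f
    using that fs mult_of.wfactors_dividesI[OF fs(2,1) _ that] assms
    by (auto simp: wfactors_def intro!: ring_irreducibleI')
  have asc: "foldr (\<otimes>) fs \<one> \<sim> r"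
    using fs(2) assoc_iff_assoc_mult[OF carr(2) assms(1)] by (simp add: wfactors_def)
  have "wfactors R fs r"
    using irr asc by (auto simp: wfactors_def ring_irreducible_def)
  then have eq: "set_mset (Irr_mset R r) = assocs R ` set fs"
    using Irr_mset_eq[OF assms(1,2) carr(1)] by (simp add: fmset_def)
  have sub: "assocs R t \<in> assocs R ` set fs"
    if t: "t \<in> carrier R" "ring_irreducible t" "t divides r" for t
  proof -
    have "t divides foldr (\<otimes>) fs \<one>"
      using t asc divides_trans[of t r] by (simp add: associated_def)
    moreover have "\<exists>f\<in>set gs. t divides f"
      if "set gs \<subseteq> carrier R" "t divides foldr (\<otimes>) gs \<one>" for gs
      using that
    proof (induction gs)
      case Nil
      then have "t \<in> Units R" using divides_one[OF t(1)] by simp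
      with ring_irreducibleE(4)[OF t(1,2)] show ?case ..
    next
      case (Cons g gs)
      then have gs: "g \<in> carrier R" "set gs \<subseteq> carrier R" "foldr (\<otimes>) gs \<one> \<in> carrier R"
        "t divides g \<otimes> foldr (\<otimes>) gs \<one>"
        by simp_all
      then have "t divides g \<or> t divides foldr (\<otimes>) gs \<one>"
        using irreducible_dvd_mult[OF t(1,2)] by simp
      then show ?case using Cons.IH gs(2) by (metis list.set_intros)
    qed
    ultimately obtain f where f: "f \<in> set fs" "t divides f" using carr by blast
    have fc: "f \<in> carrier R" using f carr by auto
    obtain c where c: "c \<in> carrier R" "f = t \<otimes> c" using f by (auto simp: factor_def)
    have "c \<in> Units R"
      using ring_irreducibleE(5)[OF fc, of t c] irr[OF f(1)] c t ring_irreducibleE(4)[OF t(1,2)]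
      by blast
    then have "t \<sim> f"
      using associatedI2'[OF c(2)] t(1) associated_sym by blast
    then show ?thesis using f fc t(1) assocs_eq_iff by blast
  qed
  show "assocs R s \<in># Irr_mset R r \<longleftrightarrow> ring_irreducible s \<and> s divides r"
  proof
    assume "assocs R s \<in># Irr_mset R r"
    then obtain f where f: "f \<in> set fs" "assocs R s = assocs R f" using eq by auto
    then have fc: "f \<in> carrier R" "s \<sim> f" using carr assms(3) assocs_eq_iff by auto
    then show "ring_irreducible s \<and> s divides r"
      using irr[OF f(1)] ring_irreducible_associated[of f s] assms(3) divides_trans[of s f r]
      by (simp add: associated_def)
  qed (simp add: eq sub assms(3))
  have "{assocs R s |s. s \<in> carrier R \<and> ring_irreducible s \<and> s divides r} \<subseteq> assocs R ` set fs"
    using sub by blast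
  then show "finite {assocs R s |s. s \<in> carrier R \<and> ring_irreducible s \<and> s divides r}"
    by (rule finite_subset) simp
qed

end

section \<open>Powers of the automorphism\<close>

locale pid_automorphism = principal_domain R for R :: "('a, 'b) ring_scheme" (structure) +
  fixes \<sigma> :: "'a \<Rightarrow> 'a"
  assumes sigma: "\<sigma> \<in> carrier (ring_AutoGroup R)"
begin

text \<open>Elements of the group are extensional functions, so the laws for powers are stated
  pointwise on the carrier.\<close>

abbreviation spow :: "int \<Rightarrow> 'a \<Rightarrow> 'a" where
  "spow n \<equiv> \<sigma> [^]\<^bsub>ring_AutoGroup R\<^esub> n"

lemma carrier_AutoGroup: "carrier (ring_AutoGroup R) = ring_auto R"
  by (simp add: ring_AutoGroup_def)

lemma group_AutoGroup: "group (ring_AutoGroup R)"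
  by (rule ring_AutoGroup_group) (rule ring_axioms)

lemma spow_auto: "spow n \<in> ring_auto R"
  using group.int_pow_closed[OF group_AutoGroup sigma] by (simp add: carrier_AutoGroup)

lemma spow_closed [simp, intro]: "x \<in> carrier R \<Longrightarrow> spow n x \<in> carrier R"
  using ring_auto_closed[OF spow_auto] .

lemma spow_hom: "spow n \<in> ring_hom R R"
  using spow_auto by (simp add: ring_auto_def)

lemma spow_mult:
  "x \<in> carrier R \<Longrightarrow> y \<in> carrier R \<Longrightarrow> spow n (x \<otimes> y) = spow n x \<otimes> spow n y"
  using ring_hom_mult[OF spow_hom] .

lemma spow_1: "spow 1 = \<sigma>"
  using group.int_pow_1[OF group_AutoGroup sigma] .

lemma sigma_closed [simp, intro]: "x \<in> carrier R \<Longrightarrow> \<sigma> x \<in> carrier R"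
  using spow_closed[of x 1] by (simp add: spow_1)

lemma sigma_mult:
  "x \<in> carrier R \<Longrightarrow> y \<in> carrier R \<Longrightarrow> \<sigma> (x \<otimes> y) = \<sigma> x \<otimes> \<sigma> y"
  using spow_mult[of x y 1] by (simp add: spow_1)

lemma spow_0: "x \<in> carrier R \<Longrightarrow> spow 0 x = x"
  and one_AutoGroup [simp]: "x \<in> carrier R \<Longrightarrow> \<one>\<^bsub>ring_AutoGroup R\<^esub> x = x"
  by (simp_all add: int_pow_def ring_AutoGroup_def BijGroup_def)

lemma spow_spow:
  assumes "x \<in> carrier R" shows "spow m (spow n x) = spow (m + n) x"
proof -
  have mult: "f \<otimes>\<^bsub>ring_AutoGroup R\<^esub> g = compose (carrier R) f g"
    if "f \<in> ring_auto R" "g \<in> ring_auto R" for f g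
    using that by (simp add: ring_AutoGroup_def BijGroup_def ring_auto_def)
  have "spow (m + n) = compose (carrier R) (spow m) (spow n)"
    unfolding group.int_pow_mult[OF group_AutoGroup sigma] by (rule mult[OF spow_auto spow_auto])
  then show ?thesis using assms by (simp add: compose_eq)
qed

text \<open>The generator \<open>x\<close> acts through \<open>inv_into\<close>; this turns it into
  the power with exponent -1, so that all shifts become integer powers.\<close>

lemma inv_into_eq_spow:
  assumes "x \<in> carrier R" shows "inv_into (carrier R) \<sigma> x = spow (- 1) x"
proof (rule inv_into_f_eq)
  show "inj_on \<sigma> (carrier R)"
    using sigma by (auto simp: carrier_AutoGroup ring_auto_def Bij_def bij_betw_def)
  show "\<sigma> (spow (- 1) x) = x"
    using assms spow_spow[of x 1 "- 1"] by (simp add: spow_1 spow_0)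
qed (use assms in simp)

lemma spow_dividesI:
  "x \<in> carrier R \<Longrightarrow> x divides y \<Longrightarrow> spow n x divides spow n y"
  unfolding factor_def by (auto simp: spow_mult)

text \<open>Applying \<open>spow n\<close> or \<open>spow (- n)\<close> to both sides preserves
  divisibility. Only the difference of the exponents matters, which is how indices are shifted
  below.\<close>

lemma spow_divides_iff:
  assumes "x \<in> carrier R" "y \<in> carrier R"
  shows "spow n x divides spow m y \<longleftrightarrow> x divides spow (m - n) y"
  using spow_dividesI[of x "spow (m - n) y" n] spow_dividesI[of "spow n x" "spow m y" "- n"] assms
  by (auto simp: spow_spow spow_0)

text \<open>Zero divides only itself and is fixed by automorphisms, so a common shift of both sides
  suffices.\<close>

lemma spow_zero_iff: "x \<in> carrier R \<Longrightarrow> spow n x = \<zero> \<longleftrightarrow> x = \<zero>"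
  using spow_divides_iff[of \<zero> x n n] ring_hom_zero[OF spow_hom[of n] ring_axioms ring_axioms]
  by (simp add: zero_divides spow_0)

lemma spow_associated_iff:
  assumes "x \<in> carrier R" "y \<in> carrier R"
  shows "spow n x \<sim> spow m y \<longleftrightarrow> x \<sim> spow (m - n) y"
  using assms spow_divides_iff[of x y n m] spow_divides_iff[of "spow (m - n) y" x n n]
  by (simp add: associated_def spow_spow spow_0)

lemma spow_irreducible:
  assumes "x \<in> carrier R" "ring_irreducible x"
  shows "ring_irreducible (spow n x)"
proof (rule ring_irreducibleI)
  note x = ring_irreducibleE[OF assms]
  have unit: "spow m u \<in> Units R" if "u \<in> Units R" for m u
  proof -
    have "u divides \<one>" using that divides_one[OF Units_closed[OF that]] by blast
    then have "spow m u divides spow m \<one>" by (rule spow_dividesI[OF Units_closed[OF that]])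
    then have "spow m u divides \<one>" unfolding ring_hom_one[OF spow_hom] .
    then show ?thesis using divides_one[of "spow m u"] Units_closed[OF that] by blast
  qed
  show "spow n x \<in> carrier R - {\<zero>}" using x assms by (simp add: spow_zero_iff)
  show "spow n x \<notin> Units R"
    using unit[of "spow n x" "- n"] x assms by (auto simp: spow_spow spow_0)
  fix b c assume bc: "b \<in> carrier R" "c \<in> carrier R" "spow n x = b \<otimes> c"
  then have "x = spow (- n) b \<otimes> spow (- n) c"
    using assms by (simp add: spow_mult[symmetric] spow_spow spow_0 flip: bc(3))
  then have "spow (- n) b \<in> Units R \<or> spow (- n) c \<in> Units R" using x(5) bc by simp
  then show "b \<in> Units R \<or> c \<in> Units R"
    using unit[of "spow (- n) b" n] unit[of "spow (- n) c" n] bc by (auto simp: spow_spow spow_0)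
qed

section \<open>Orbits of classes of irreducibles, and products along an orbit\<close>

lemma action_spow:
  assumes "r \<in> carrier R" "ring_irreducible r"
  shows "Irr_action R (spow n) (assocs R r) = assocs R (spow n r)"
  using Irr_action_assocs[OF ring_axioms spow_auto assms] .

lemma orbit_eq:
  assumes "r \<in> carrier R" "ring_irreducible r"
  shows "orbit (cyclic_auto_group R \<sigma>) (Irr_action R) (assocs R r) =
    range (\<lambda>n. assocs R (spow n r))"
  using group.generate_pow[OF group_AutoGroup sigma] action_spow[OF assms]
  by (auto simp: orbit_def cyclic_auto_group_def)

lemma orbits_eq:
  "orbits (cyclic_auto_group R \<sigma>) (Irr_set R) (Irr_action R) =
    {range (\<lambda>n. assocs R (spow n r)) |r. r \<in> carrier R \<and> ring_irreducible r}"
  unfolding orbits_def Irr_set_def using orbit_eq by blast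

lemma same_orbit_iff:
  assumes "r \<in> carrier R" "ring_irreducible r" "s \<in> carrier R" "ring_irreducible s"
  shows "(\<exists>Q \<in> orbits (cyclic_auto_group R \<sigma>) (Irr_set R) (Irr_action R).
      assocs R r \<in> Q \<and> assocs R s \<in> Q) \<longleftrightarrow> (\<exists>n. r \<sim> spow n s)"
proof
  assume "\<exists>Q \<in> orbits (cyclic_auto_group R \<sigma>) (Irr_set R) (Irr_action R).
      assocs R r \<in> Q \<and> assocs R s \<in> Q"
  then obtain t m n where t: "t \<in> carrier R" "assocs R r = assocs R (spow m t)"
      "assocs R s = assocs R (spow n t)"
    unfolding orbits_eq by blast
  then have "r \<sim> spow m t" "s \<sim> spow n t" using assms assocs_eq_iff by auto
  \<comment> \<open>Both elements are shifts of the base point \<open>t\<close>; moving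
    \<open>s\<close> by \<open>m - n\<close> aligns it with \<open>r\<close>.\<close>
  moreover have "spow (m - n) s \<sim> spow m t"
    using spow_associated_iff[of s t "m - n" m] \<open>s \<sim> spow n t\<close> assms t by simp
  ultimately show "\<exists>n. r \<sim> spow n s"
    using associated_sym associated_trans t(1) assms by (meson spow_closed)
next
  assume "\<exists>n. r \<sim> spow n s"
  then have "assocs R r \<in> range (\<lambda>n. assocs R (spow n s))"
    using assms assocs_eq_iff by auto
  moreover have "assocs R s \<in> range (\<lambda>n. assocs R (spow n s))"
    using assms spow_0[of s] by (metis rangeI)
  ultimately show "\<exists>Q \<in> orbits (cyclic_auto_group R \<sigma>) (Irr_set R) (Irr_action R).
      assocs R r \<in> Q \<and> assocs R s \<in> Q"
    unfolding orbits_eq using assms by blast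
qed

lemma Irr_le_iff:
  assumes "r \<in> carrier R" "ring_irreducible r" "s \<in> carrier R" "ring_irreducible s"
  shows "Irr_le R \<sigma> (assocs R r) (assocs R s) \<longleftrightarrow> (\<exists>n\<ge>0. spow n r \<sim> s)"
proof -
  have "Irr_action R (\<sigma> [^]\<^bsub>ring_AutoGroup R\<^esub> n) (assocs R r) = assocs R s \<longleftrightarrow>
      spow (int n) r \<sim> s" for n :: nat
    using action_spow[OF assms(1,2), of "int n"]
      assocs_eq_iff[OF spow_closed[OF assms(1)] assms(3), of "int n"]
    by (simp add: int_pow_int)
  moreover have "assocs R r \<in> Irr_set R" "assocs R s \<in> Irr_set R"
    using assms by (auto simp: Irr_set_def)
  ultimately show ?thesis
    unfolding Irr_le_def by (metis nonneg_int_cases of_nat_0_le_iff)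
qed

text \<open>An orbit of a cyclic group is finite exactly when some positive power fixes the class:
  two equal members give a period, and a period \<open>n\<close> reduces every exponent modulo
  \<open>n\<close>.\<close>

lemma infinite_orbits_iff:
  "infinite_orbits R \<sigma> \<longleftrightarrow>
    (\<forall>r \<in> carrier R. ring_irreducible r \<longrightarrow> (\<forall>n>0. \<not> spow n r \<sim> r))"
proof -
  have "finite (range (\<lambda>n. assocs R (spow n r))) \<longleftrightarrow> (\<exists>n>0. spow n r \<sim> r)"
    (is "finite (range ?f) \<longleftrightarrow> _") if r: "r \<in> carrier R" for r
  proof
    assume "finite (range ?f)"
    then have "\<not> inj ?f" using finite_imageD infinite_UNIV_int by blast
    then obtain m n where "m < n" "?f n = ?f m"
      unfolding inj_def by (metis linorder_neq_iff)
    then show "\<exists>n>0. spow n r \<sim> r"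
      using r spow_associated_iff[of r r m n] assocs_eq_iff[of "spow n r" "spow m r"]
      by (intro exI[of _ "n - m"]) (simp add: associated_sym)
  next
    assume "\<exists>n>0. spow n r \<sim> r"
    then obtain n where n: "n > 0" "spow n r \<sim> r" by blast
    have step: "?f (k + n) = ?f k" for k
      using r n(2) spow_associated_iff[of r r k "k + n"] assocs_eq_iff[of "spow (k + n) r" "spow k r"]
      by (simp add: associated_sym)
    have period: "?f (k + j * n) = ?f k" for j k
    proof (induction j rule: int_induct[of _ 0])
      case (step1 i)
      then show ?case using step[of "k + i * n"] by (simp add: algebra_simps)
    next
      case (step2 i)
      then show ?case using step[of "k + (i - 1) * n"] by (simp add: algebra_simps)
    qed simp
    have "?f k \<in> ?f ` {0..<n}" for k
      using period[of "k mod n" "k div n"] n(1) by (intro image_eqI[of _ _ "k mod n"]) simp_all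
    then have "range ?f \<subseteq> ?f ` {0..<n}" by blast
    then show "finite (range ?f)" by (rule finite_subset) simp
  qed
  then show ?thesis
    unfolding infinite_orbits_def orbits_eq by blast
qed

text \<open>The witness is \<open>d = r \<sigma>(r) \<cdots> \<sigma>\<^sup>k(r)\<close>.\<close>

lemma orbit_product:
  assumes r: "r \<in> carrier R" "ring_irreducible r"
  obtains d where "d \<in> carrier R" "d \<noteq> \<zero>" "d \<notin> Units R"
    and "\<sigma> d \<otimes> r = d \<otimes> spow (int k + 1) r"
    and "spow (- 1) d \<otimes> spow (int k) r = d \<otimes> spow (- 1) r"
proof -
  \<comment> \<open>The induction carries \<open>r divides d\<close>, which survives multiplication
    and shows at the end that \<open>d\<close> is not a unit.\<close>
  have "\<exists>d\<in>carrier R. d \<noteq> \<zero> \<and> r divides d \<and> \<sigma> d \<otimes> r = d \<otimes> spow (int k + 1) r"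
  proof (induction k)
    case 0
    show ?case
      using r ring_irreducibleE(1)[OF r] by (intro bexI[of _ r]) (simp_all add: spow_1 m_comm)
  next
    case (Suc k)
    then obtain d where d: "d \<in> carrier R" "d \<noteq> \<zero>" "r divides d"
      "\<sigma> d \<otimes> r = d \<otimes> spow (int k + 1) r" by blast
    \<comment> \<open>\<open>t\<close> is the next factor of the product, and
      \<open>\<sigma> t\<close> is the one just past the new end.\<close>
    define t where "t = spow (int k + 1) r"
    have t: "t \<in> carrier R" "t \<noteq> \<zero>" "\<sigma> t = spow (int (Suc k) + 1) r"
      unfolding t_def using r ring_irreducibleE(1)[OF r] spow_spow[of r 1]
      by (auto simp: spow_zero_iff spow_1 add_ac)
    have "\<sigma> (d \<otimes> t) \<otimes> r = (\<sigma> d \<otimes> r) \<otimes> \<sigma> t"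
      using d(1) t(1) r(1) by (simp add: sigma_mult m_ac)
    also have "\<dots> = (d \<otimes> t) \<otimes> spow (int (Suc k) + 1) r" using d(4) t(3) t_def by simp
    finally show ?case
      using d t r by (intro bexI[of _ "d \<otimes> t"]) (simp_all add: integral_iff divides_prod_r)
  qed
  then obtain d where d: "d \<in> carrier R" "d \<noteq> \<zero>" "r divides d"
    "\<sigma> d \<otimes> r = d \<otimes> spow (int k + 1) r" by blast
  \<comment> \<open>The second equation is the first one after applying
    \<open>spow (- 1)\<close>.\<close>
  have "spow (- 1) (spow 1 d \<otimes> r) = spow (- 1) (d \<otimes> spow (int k + 1) r)"
    using d(4) by (simp add: spow_1)
  then have "d \<otimes> spow (- 1) r = spow (- 1) d \<otimes> spow (int k) r"
    using d(1) r(1) by (simp add: spow_mult spow_spow spow_0)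
  moreover have "d \<notin> Units R"
    using d r ring_irreducibleE(4)[OF r] divides_unit by blast
  ultimately show thesis using that d by simp
qed

section \<open>Submodules as stable principal ideals\<close>

text \<open>Reduces simplicity to a divisibility condition on a single element: zero generates the
  zero submodule, units generate the whole module, and any other \<open>d\<close> meeting the two
  conditions generates something strictly between.\<close>

lemma V_mod_simple_iff:
  assumes a: "a \<in> carrier R" "a \<noteq> \<zero>" and p: "p \<in> carrier R" "p divides a"
    and q: "q = \<sigma> (exact_quotient R a p)"
  shows "simple_left_module (GWA R \<sigma> a) (V_mod R \<sigma> a p) \<longleftrightarrow>
    (\<forall>d \<in> carrier R. d divides spow (- 1) d \<otimes> p \<and> d divides \<sigma> d \<otimes> q \<longrightarrow>
      d = \<zero> \<or> d \<in> Units R)"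
proof -
  let ?A = "GWA R \<sigma> a" and ?V = "V_mod R \<sigma> a p"
  have sg: "\<sigma> \<in> ring_auto R" using sigma by (simp add: carrier_AutoGroup)
  have qc: "q \<in> carrier R"
    using exact_quotient[OF domain_axioms sg a p] q by simp
  note act = V_mod_smult[OF domain_axioms sg a p, folded q]
  note act_closed = gwa_act_closed[OF domain_axioms sg a p, folded q]
  have [simp]: "carrier ?A = gwa_class R \<sigma> a ` gwa_exprs R"
    by (simp add: GWA_def)
  have V [simp]: "carrier ?V = carrier R" "add ?V = add R" "\<zero>\<^bsub>?V\<^esub> = \<zero>"
    by (simp_all add: V_mod_def)
  \<comment> \<open>The two additive monoids share carrier, operation and neutral element, hence
    inverses, and \<open>subgroup\<close> looks at nothing else.\<close>
  have subgroup_V: "subgroup N (add_monoid ?V) \<longleftrightarrow> subgroup N (add_monoid R)" for N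
    by (simp add: subgroup_def m_inv_def)
  have sub: "submodule (PIdl d) ?A ?V"
    if d: "d \<in> carrier R" "d divides spow (- 1) d \<otimes> p" "d divides \<sigma> d \<otimes> q" for d
  proof -
    have mem: "r \<in> PIdl d \<longleftrightarrow> r \<in> carrier R \<and> d divides r" for r
      using d(1) by (auto simp: cgenideal_def factor_def m_comm)
    \<comment> \<open>The element \<open>r\<close> must be arbitrary in the induction, since in a
      product the outer expression acts on the result of the inner one.\<close>
    have closed: "gwa_act R \<sigma> p q e r \<in> PIdl d" if "e \<in> gwa_exprs R" "r \<in> PIdl d" for e r
      using that
    proof (induction e arbitrary: r)
      case (Const c)
      then show ?case using d by (auto simp: mem divides_prod_l)
    next
      case Gen_x
      then obtain c where c: "c \<in> carrier R" "r = d \<otimes> c" unfolding mem factor_def by auto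
      then have "gwa_act R \<sigma> p q Gen_x r = (spow (- 1) d \<otimes> p) \<otimes> spow (- 1) c"
        using d p by (simp add: inv_into_eq_spow spow_mult m_ac)
      then show ?case using d c p by (simp add: mem divides_prod_r)
    next
      case Gen_y
      then obtain c where c: "c \<in> carrier R" "r = d \<otimes> c" unfolding mem factor_def by auto
      then have "gwa_act R \<sigma> p q Gen_y r = (\<sigma> d \<otimes> q) \<otimes> \<sigma> c"
        using d qc by (simp add: sigma_mult m_ac)
      then show ?case using d c qc by (simp add: mem divides_prod_r)
    next
      case (Add e f)
      then show ?case
        using additive_subgroup.a_closed[OF ideal.axioms(1)[OF cgenideal_ideal[OF d(1)]]] by simp
    next
      case (Neg e)
      then show ?case
        using additive_subgroup.a_inv_closed[OF ideal.axioms(1)[OF cgenideal_ideal[OF d(1)]]] by simp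
    qed simp
    show ?thesis
    proof (intro submodule.intro submodule_axioms.intro)
      show "subgroup (PIdl d) (add_monoid ?V)"
        unfolding subgroup_V
        by (rule additive_subgroup.a_subgroup[OF ideal.axioms(1)[OF cgenideal_ideal[OF d(1)]]])
    next
      fix C r assume "C \<in> carrier ?A" "r \<in> PIdl d"
      then show "C \<odot>\<^bsub>?V\<^esub> r \<in> PIdl d"
        using closed act by (auto simp: mem)
    qed
  qed
  have gen: "\<exists>d\<in>carrier R. N = PIdl d \<and> d divides spow (- 1) d \<otimes> p \<and> d divides \<sigma> d \<otimes> q"
    if N: "submodule N ?A ?V" for N
  proof -
    have sgr: "subgroup N (add_monoid R)"
      using N unfolding submodule_def subgroup_V by simp
    then have Nc: "N \<subseteq> carrier R" using subgroup.subset by fastforce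
    have cl: "gwa_act R \<sigma> p q e r \<in> N" if "e \<in> gwa_exprs R" "r \<in> N" for e r
      using submodule.smult_closed[OF N, of "gwa_class R \<sigma> a e" r] that act[of e r] Nc by auto
    have "c \<otimes> r \<in> N" "r \<otimes> c \<in> N" if "c \<in> carrier R" "r \<in> N" for c r
      using cl[of "Const c" r] that Nc m_comm[of r c] by auto
    then have "ideal N R"
      using Nc by (intro idealI[OF ring_axioms sgr]) auto
    then obtain d where d: "d \<in> carrier R" "N = PIdl d" using exists_gen by blast
    have mem: "r \<in> N \<longleftrightarrow> r \<in> carrier R \<and> d divides r" for r
      using d by (auto simp: cgenideal_def factor_def m_comm)
    have "d \<in> N" using d by (simp add: cgenideal_self)
    \<comment> \<open>Letting \<open>x\<close> and \<open>y\<close> act on the generator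
      \<open>d\<close> itself gives the two divisibility conditions.\<close>
    then show ?thesis
      using cl[of Gen_x d] cl[of Gen_y d] d(1) mem
      by (intro bexI[of _ d]) (auto simp: inv_into_eq_spow d(2)[symmetric])
  qed
  have triv: "PIdl d = {\<zero>} \<or> PIdl d = carrier R \<longleftrightarrow> d = \<zero> \<or> d \<in> Units R"
    if "d \<in> carrier R" for d
  proof -
    have "PIdl \<zero> = {\<zero>}" by (auto simp: cgenideal_def intro!: exI[of _ \<zero>])
    then have "PIdl d = {\<zero>} \<longleftrightarrow> d = \<zero>"
      using cgenideal_self[OF that] by (metis singletonD)
    then show ?thesis using ideal_eq_carrier_iff[OF that] by auto
  qed
  have nz: "carrier ?V \<noteq> {\<zero>\<^bsub>?V\<^esub>}" using a by auto
  show ?thesis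
  proof (intro iffI ballI impI)
    fix d assume s: "simple_left_module ?A ?V" and d: "d \<in> carrier R"
      "d divides spow (- 1) d \<otimes> p \<and> d divides \<sigma> d \<otimes> q"
    then show "d = \<zero> \<or> d \<in> Units R"
      using simple_left_module.submodule_trivial[OF s sub[of d]] triv[of d] by simp
  next
    assume *: "\<forall>d \<in> carrier R. d divides spow (- 1) d \<otimes> p \<and> d divides \<sigma> d \<otimes> q \<longrightarrow>
      d = \<zero> \<or> d \<in> Units R"
    show "simple_left_module ?A ?V"
    proof (intro simple_left_module.intro simple_left_module_axioms.intro nz)
      show "left_module ?A ?V" by (rule V_mod_left_module[OF domain_axioms sg a p])
      fix N assume "submodule N ?A ?V"
      from gen[OF this] show "N = {\<zero>\<^bsub>?V\<^esub>} \<or> N = carrier ?V"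
        using * triv by auto
    qed
  qed
qed

text \<open>Infinite orbits make the exponents of \<open>r\<close> correspond injectively to
  classes, so only finitely many shifts of \<open>r\<close> divide \<open>d\<close> and the extreme
  exponents exist.\<close>

lemma irreducible_chain_ends:
  assumes inf: "infinite_orbits R \<sigma>"
    and d: "d \<in> carrier R" "d \<noteq> \<zero>" "d \<notin> Units R"
    and p: "p \<in> carrier R" "d divides spow (- 1) d \<otimes> p"
    and q: "q \<in> carrier R" "d divides \<sigma> d \<otimes> q"
  obtains r m n where "r \<in> carrier R" "ring_irreducible r" "m \<le> n"
    "spow n r divides p" "spow m r divides q"
proof -
  obtain r where r: "r \<in> carrier R" "ring_irreducible r" "r divides d"
    using exists_irreducible_divisor[of d] d by blast
  define D where "D = {n. spow n r divides d}"
  have "0 \<in> D" using r by (simp add: D_def spow_0)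
  have "inj (\<lambda>n. assocs R (spow n r))"
  proof (rule linorder_injI)
    fix m n :: int assume "m < n"
    then show "assocs R (spow m r) \<noteq> assocs R (spow n r)"
      using inf r spow_associated_iff[of r r m n] assocs_eq_iff[of "spow m r" "spow n r"]
        associated_sym[of r "spow (n - m) r"]
      by (auto simp: infinite_orbits_iff)
  qed
  moreover have "(\<lambda>n. assocs R (spow n r)) ` D \<subseteq>
      {assocs R s |s. s \<in> carrier R \<and> ring_irreducible s \<and> s divides d}"
    using r by (auto simp: D_def intro: spow_irreducible)
  ultimately have "finite D"
    using in_Irr_mset_iff(2)[OF d(1,2) d(1)] by (meson finite_imageD finite_subset inj_on_subset subset_UNIV)
  define m n where "m = Min D" and "n = Max D"
  have D: "m \<in> D" "n \<in> D" "m \<le> n"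
    using \<open>finite D\<close> \<open>0 \<in> D\<close> by (auto simp: m_def n_def intro: Min_in Max_in order.trans[of _ 0])
  have "n + 1 \<notin> D" using Max_ge[OF \<open>finite D\<close>, of "n + 1"] by (auto simp: n_def)
  moreover have "m - 1 \<notin> D" using Min_le[OF \<open>finite D\<close>, of "m - 1"] by (auto simp: m_def)
  \<comment> \<open>That \<open>spow (n + 1) r\<close> does not divide \<open>d\<close> is, shifted
    by -1, the claim about \<open>spow n r\<close>; the lower end is shifted by 1. Since
    irreducibles are prime here, the ends must then divide \<open>p\<close> and
    \<open>q\<close>.\<close>
  ultimately have nd: "\<not> spow n r divides spow (- 1) d" "\<not> spow m r divides spow 1 d"
    using r d spow_divides_iff[of r d "n + 1" 0] spow_divides_iff[of r d n "- 1"]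
      spow_divides_iff[of r d "m - 1" 0] spow_divides_iff[of r d m 1]
    by (auto simp: D_def spow_0 algebra_simps)
  have "spow n r divides d" "spow m r divides d" using D by (simp_all add: D_def)
  then have "spow n r divides spow (- 1) d \<otimes> p" "spow m r divides spow 1 d \<otimes> q"
    using divides_trans[OF _ p(2)] divides_trans[OF _ q(2)] r(1) by (simp_all add: spow_1)
  then have "spow n r divides p" "spow m r divides q"
    using nd r d p q irreducible_dvd_mult[of "spow n r" "spow (- 1) d" p]
      irreducible_dvd_mult[of "spow m r" "spow 1 d" q] by (auto simp: spow_irreducible)
  then show thesis using that r D by blast
qed

end

section \<open>Assembling the two criteria for simplicity\<close>

theorem corollary3p1:
  fixes R :: "('a, 'b) ring_scheme" and \<sigma> :: "'a \<Rightarrow> 'a" and a p q :: 'a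
  assumes "principal_domain R"
    and "\<sigma> \<in> carrier (ring_AutoGroup R)"
    and "a \<in> carrier R" and "a \<noteq> \<zero>\<^bsub>R\<^esub>"
    and "p \<in> carrier R" and "p divides\<^bsub>R\<^esub> a"
    and "q = \<sigma> (exact_quotient R a p)"
  shows "(simple_left_module (GWA R \<sigma> a) (V_mod R \<sigma> a p) \<longleftrightarrow>
           infinite_orbits R \<sigma> \<and> orbit_condition R \<sigma> p q) \<and>
         (simple_left_module (GWA R \<sigma> a) (V_mod R \<sigma> a p) \<longleftrightarrow>
           infinite_orbits R \<sigma> \<and> orbit_condition_pow R \<sigma> p q)"
proof -
  interpret pid_automorphism R \<sigma>
    using assms by (simp add: pid_automorphism_def pid_automorphism_axioms_def)
  define b where "b = exact_quotient R a p"
  have b: "b \<in> carrier R" "a = p \<otimes>\<^bsub>R\<^esub> b"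
    using exact_quotient[OF domain_axioms _ assms(3-6)] assms(2)
    by (auto simp: b_def carrier_AutoGroup)
  have "b \<noteq> \<zero>\<^bsub>R\<^esub>" and p0: "p \<noteq> \<zero>\<^bsub>R\<^esub>" using b assms(4,5) by auto
  moreover have "q = spow 1 b" using assms(7) by (simp add: b_def spow_1)
  ultimately have qc: "q \<in> carrier R" "q \<noteq> \<zero>\<^bsub>R\<^esub>" using b(1) by (auto simp: spow_zero_iff)
  let ?S = "simple_left_module (GWA R \<sigma> a) (V_mod R \<sigma> a p)"
  \<comment> \<open>\<open>P\<close> is the power condition in terms of divisibility. It links both
    criteria: simplicity is shown equivalent to infinite orbits together with
    \<open>P\<close>.\<close>
  define P where "P \<longleftrightarrow> (\<forall>r \<in> carrier R. \<forall>n. ring_irreducible\<^bsub>R\<^esub> r \<and> r divides\<^bsub>R\<^esub> q \<and>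
    spow n r divides\<^bsub>R\<^esub> p \<longrightarrow> n < 0)"
  have "infinite_orbits R \<sigma> \<and> P" if simple: ?S
  proof
    have unit_or_zero: "d = \<zero>\<^bsub>R\<^esub> \<or> d \<in> Units R"
      if "d \<in> carrier R" "d divides\<^bsub>R\<^esub> spow (- 1) d \<otimes>\<^bsub>R\<^esub> p" "d divides\<^bsub>R\<^esub> \<sigma> d \<otimes>\<^bsub>R\<^esub> q" for d
      using simple V_mod_simple_iff[OF assms(3-7)] that by blast
    show "infinite_orbits R \<sigma>"
      unfolding infinite_orbits_iff
    proof (intro ballI impI allI notI)
      fix r n assume r: "r \<in> carrier R" "ring_irreducible\<^bsub>R\<^esub> r"
        and n: "(n::int) > 0" "spow n r \<sim>\<^bsub>R\<^esub> r"
      \<comment> \<open>With length parameter \<open>n - 1\<close> the product runs over a full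
        period, and the factor \<open>spow n r\<close> past its end is associated to
        \<open>r\<close>.\<close>
      obtain d where d: "d \<in> carrier R" "d \<noteq> \<zero>\<^bsub>R\<^esub>" "d \<notin> Units R"
        "\<sigma> d \<otimes>\<^bsub>R\<^esub> r = d \<otimes>\<^bsub>R\<^esub> spow n r"
        "spow (- 1) d \<otimes>\<^bsub>R\<^esub> spow (n - 1) r = d \<otimes>\<^bsub>R\<^esub> spow (- 1) r"
        using orbit_product[OF r, of "nat (n - 1)"] n(1) by auto
      \<comment> \<open>The end factors are cancelled in the domain, so \<open>d\<close> divides
        both of its own shifts and therefore meets the conditions for every \<open>p\<close> and
        \<open>q\<close>.\<close>
      have cancel: "d divides\<^bsub>R\<^esub> e"
        if et: "e \<in> carrier R" "s \<in> carrier R" "t \<in> carrier R" "t \<noteq> \<zero>\<^bsub>R\<^esub>"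
          "e \<otimes>\<^bsub>R\<^esub> t = d \<otimes>\<^bsub>R\<^esub> s" "t divides\<^bsub>R\<^esub> s" for e s t
      proof -
        obtain c where c: "c \<in> carrier R" "s = t \<otimes>\<^bsub>R\<^esub> c" using et(6) by (auto simp: factor_def)
        then have "t \<otimes>\<^bsub>R\<^esub> e = t \<otimes>\<^bsub>R\<^esub> (d \<otimes>\<^bsub>R\<^esub> c)"
          using et d(1) by (simp add: m_ac)
        then have "e = d \<otimes>\<^bsub>R\<^esub> c" using et d(1) c(1) m_lcancel by simp
        then show ?thesis using c(1) by (auto simp: factor_def)
      qed
      have r0: "r \<noteq> \<zero>\<^bsub>R\<^esub>" using ring_irreducibleE(1)[OF r] .
      have "d divides\<^bsub>R\<^esub> spow 1 d"
        using cancel[of "spow 1 d" "spow n r" r] d r n r0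
        by (simp add: associated_def spow_1)
      moreover have "d divides\<^bsub>R\<^esub> spow (- 1) d"
      proof -
        have "spow n r divides\<^bsub>R\<^esub> spow 0 r" using n(2) r by (simp add: associated_def spow_0)
        then have "spow (n - 1) r divides\<^bsub>R\<^esub> spow (- 1) r"
          using spow_divides_iff[OF r(1) r(1), of n 0] spow_divides_iff[OF r(1) r(1), of "n - 1" "- 1"]
          by simp
        then show ?thesis
          using cancel[OF _ _ _ _ d(5)] d(1) r(1) r0 by (simp add: spow_zero_iff)
      qed
      ultimately show False
        using unit_or_zero[of d] d assms(5) qc by (simp add: divides_prod_r spow_1)
    qed
    show P
      unfolding P_def
    proof (intro ballI allI impI)
      fix r n assume r: "r \<in> carrier R" and *: "ring_irreducible\<^bsub>R\<^esub> r \<and> r divides\<^bsub>R\<^esub> q \<and>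
        spow n r divides\<^bsub>R\<^esub> p"
      show "n < 0"
      proof (rule ccontr)
        assume "\<not> n < 0"
        \<comment> \<open>Here the chain runs from \<open>r\<close>, a divisor of \<open>q\<close>,
          to \<open>spow n r\<close>, a divisor of \<open>p\<close>.\<close>
        then obtain d where d: "d \<in> carrier R" "d \<noteq> \<zero>\<^bsub>R\<^esub>" "d \<notin> Units R"
          "\<sigma> d \<otimes>\<^bsub>R\<^esub> r = d \<otimes>\<^bsub>R\<^esub> spow (n + 1) r"
          "spow (- 1) d \<otimes>\<^bsub>R\<^esub> spow n r = d \<otimes>\<^bsub>R\<^esub> spow (- 1) r"
          using orbit_product[OF r, of "nat n"] * by auto
        \<comment> \<open>Instead of cancelling the end factor \<open>t'\<close>, this enlarges it
          to its multiple \<open>t\<close>, which will be \<open>q\<close> or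
          \<open>p\<close>.\<close>
        have extend: "d divides\<^bsub>R\<^esub> e \<otimes>\<^bsub>R\<^esub> t"
          if et: "e \<in> carrier R" "s \<in> carrier R" "t' \<in> carrier R"
            "e \<otimes>\<^bsub>R\<^esub> t' = d \<otimes>\<^bsub>R\<^esub> s" "t' divides\<^bsub>R\<^esub> t" for e s t t'
        proof -
          have "d divides\<^bsub>R\<^esub> e \<otimes>\<^bsub>R\<^esub> t'" using et(2,4) by (auto simp: factor_def)
          then show ?thesis using divides_trans divides_mult_lI[OF et(5,3,1)] d(1) by blast
        qed
        have "d divides\<^bsub>R\<^esub> spow 1 d \<otimes>\<^bsub>R\<^esub> q" "d divides\<^bsub>R\<^esub> spow (- 1) d \<otimes>\<^bsub>R\<^esub> p"
          using extend[of "spow 1 d" "spow (n + 1) r" r q]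
            extend[of "spow (- 1) d" "spow (- 1) r" "spow n r" p] d r *
          by (simp_all add: spow_1)
        then show False using unit_or_zero[of d] d by (simp add: spow_1)
      qed
    qed
  qed
  moreover have ?S if inf: "infinite_orbits R \<sigma>" and P
    unfolding V_mod_simple_iff[OF assms(3-7)]
  proof (intro ballI impI)
    fix d assume d: "d \<in> carrier R" "d divides\<^bsub>R\<^esub> spow (- 1) d \<otimes>\<^bsub>R\<^esub> p \<and> d divides\<^bsub>R\<^esub> \<sigma> d \<otimes>\<^bsub>R\<^esub> q"
    show "d = \<zero>\<^bsub>R\<^esub> \<or> d \<in> Units R"
    proof (rule ccontr)
      assume "\<not> (d = \<zero>\<^bsub>R\<^esub> \<or> d \<in> Units R)"
      then obtain r m n where r: "r \<in> carrier R" "ring_irreducible\<^bsub>R\<^esub> r" "m \<le> n"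
        "spow n r divides\<^bsub>R\<^esub> p" "spow m r divides\<^bsub>R\<^esub> q"
        using irreducible_chain_ends[OF inf, of d p q] d assms(5) qc by blast
      \<comment> \<open>The chain is rebased at its lower end, the divisor of \<open>q\<close>, so
        that \<open>P\<close> applies with the nonnegative exponent \<open>n - m\<close>.\<close>
      then have "spow (n - m) (spow m r) divides\<^bsub>R\<^esub> p" by (simp add: spow_spow)
      then have "n - m < 0"
        using \<open>P\<close> r spow_irreducible[OF r(1,2), of m] unfolding P_def by blast
      then show False using r(3) by simp
    qed
  qed
  \<comment> \<open>As \<open>p\<close> and \<open>q\<close> are nonzero, membership in the
    multisets is divisibility by an irreducible, and shifts of irreducibles are irreducible.\<close>
  moreover have "orbit_condition_pow R \<sigma> p q \<longleftrightarrow> P"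
    unfolding orbit_condition_pow_def P_def
    using in_Irr_mset_iff(1)[OF qc] in_Irr_mset_iff(1)[OF assms(5) p0] spow_irreducible
    by (auto 0 4)
  moreover have "orbit_condition R \<sigma> p q \<longleftrightarrow> P" if inf: "infinite_orbits R \<sigma>"
  proof -
    have noloop: "\<not> spow n r \<sim>\<^bsub>R\<^esub> r" if "r \<in> carrier R" "ring_irreducible\<^bsub>R\<^esub> r" "n > 0" for r n
      using inf that by (simp add: infinite_orbits_iff)
    show ?thesis
    proof
      assume oc: "orbit_condition R \<sigma> p q"
      show P
        unfolding P_def
      proof (intro ballI allI impI)
        fix r n assume r: "r \<in> carrier R" and *: "ring_irreducible\<^bsub>R\<^esub> r \<and> r divides\<^bsub>R\<^esub> q \<and>
          spow n r divides\<^bsub>R\<^esub> p"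
        have irr: "ring_irreducible\<^bsub>R\<^esub> (spow n r)" using spow_irreducible r * by blast
        have "\<exists>m. spow n r \<sim>\<^bsub>R\<^esub> spow m r" using r by blast
        then have "Irr_le R \<sigma> (assocs R (spow n r)) (assocs R r) \<and> \<not> spow n r \<sim>\<^bsub>R\<^esub> r"
          using oc r * irr same_orbit_iff[of "spow n r" r] unfolding orbit_condition_def by auto
        then obtain k where k: "k \<ge> 0" "spow (k + n) r \<sim>\<^bsub>R\<^esub> r" "\<not> spow n r \<sim>\<^bsub>R\<^esub> r"
          using Irr_le_iff[of "spow n r" r] r * irr by (auto simp: spow_spow)
        \<comment> \<open>A positive \<open>k + n\<close> would be a period of \<open>r\<close>, so
          \<open>n\<close> is at most \<open>- k\<close>; the value 0 is excluded because
          \<open>spow n r\<close> and \<open>r\<close> are not associated.\<close>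
        then have "n \<noteq> 0" "\<not> k + n > 0" using noloop r * by (auto simp: spow_0)
        then show "n < 0" using k(1) by simp
      qed
    next
      assume P
      show "orbit_condition R \<sigma> p q"
        unfolding orbit_condition_def
      proof (intro ballI impI)
        fix s r assume c: "s \<in> carrier R" "r \<in> carrier R"
          and *: "ring_irreducible\<^bsub>R\<^esub> s \<and> s divides\<^bsub>R\<^esub> p \<and> ring_irreducible\<^bsub>R\<^esub> r \<and> r divides\<^bsub>R\<^esub> q \<and>
            (\<exists>Q\<in>orbits (cyclic_auto_group R \<sigma>) (Irr_set R) (Irr_action R).
              assocs R s \<in> Q \<and> assocs R r \<in> Q)"
        then obtain n where n: "s \<sim>\<^bsub>R\<^esub> spow n r" using same_orbit_iff[of s r] by blast
        then have "spow n r divides\<^bsub>R\<^esub> p"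
          using * c divides_trans[of "spow n r" s p] by (simp add: associated_def)
        then have n0: "n < 0" using \<open>P\<close> c * unfolding P_def by blast
        \<comment> \<open>Inverting the shift gives the positive exponent \<open>- n\<close> that
          leads from \<open>s\<close> to \<open>r\<close>, as \<open>Irr_le\<close> demands. If
          \<open>s\<close> and \<open>r\<close> were associated, it would be a period of
          \<open>s\<close>.\<close>
        have s: "spow (- n) s \<sim>\<^bsub>R\<^esub> r"
          using n c spow_associated_iff[of s r "- n" 0] by (simp add: spow_0)
        have "\<not> s \<sim>\<^bsub>R\<^esub> r"
        proof
          assume "s \<sim>\<^bsub>R\<^esub> r"
          then have "spow (- n) s \<sim>\<^bsub>R\<^esub> s"
            using associated_trans[OF s associated_sym] c by blast
          then show False using noloop[of s "- n"] n0 c * by simp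
        qed
        then show "Irr_le R \<sigma> (assocs R s) (assocs R r) \<and> \<not> s \<sim>\<^bsub>R\<^esub> r"
          using Irr_le_iff[of s r] c * s n0 by (auto intro: exI[of _ "- n"])
      qed
    qed
  qed
  ultimately show ?thesis by blast
qed

end
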